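(* Let $H$ be a linear space over $\mathbb{K}$ ($\mathbb{K}=\mathbb{R}$ or $\mathbb{C}$) and $b_2,\dots,b_n\in H$ fixed elements. Let $T$ be a symmetric $b$-sesquilinear functional defined on $H\times H\times\langle b_2\rangle\times\cdots\times\langle b_n\rangle$ and let $T'$ be the associated quadratic form. (i) If $\mathbb{K}=\mathbb{R}$, then for all $x,y\in H$, $$T(x,y,b_2,\dots,b_n)=\tfrac14\left[T'(x+y,b_2,\dots,b_n)-T'(x-y,b_2,\dots,b_n)\right].$$ (ii) If $\mathbb{K}=\mathbb{C}$, then for all $x,y\in H$, $$T(x,y,b_2,\dots,b_n)=\tfrac14\left[T'(x+y,b_2,\dots,b_n)-T'(x-y,b_2,\dots,b_n)\right]+\tfrac14\left[i\,T'(x+iy,b_2,\dots,b_n)-i\,T'(x-iy,b_2,\dots,b_n)\right].$$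
   Context: $n$ is a positive integer and $\langle b_i\rangle$ denotes the subspace of $H$ generated by $b_i$. A $b$-sesquilinear functional on $H\times H\times\langle b_2\rangle\times\cdots\times\langle b_n\rangle$ is a map $T:H\times H\times\langle b_2\rangle\times\cdots\times\langle b_n\rangle\to\mathbb{K}$ such that for all $x,y,z\in H$ and $\alpha,\beta\in\mathbb{K}$: (i) $T(x+y,z,b_2,\dots,b_n)=T(x,z,b_2,\dots,b_n)+T(y,z,b_2,\dots,b_n)$; (ii) $T(\alpha x,y,b_2,\dots,b_n)=\alpha T(x,y,b_2,\dots,b_n)$; (iii) $T(x,y+z,b_2,\dots,b_n)=T(x,y,b_2,\dots,b_n)+T(x,z,b_2,\dots,b_n)$; (iv) $T(x,\beta y,b_2,\dots,b_n)=\overline{\beta}\,T(x,y,b_2,\dots,b_n)$. $T$ is symmetric if $T(x,y,b_2,\dots,b_n)=\overline{T(y,x,b_2,\dots,b_n)}$ for all $x,y\in H$. The quadratic form associated with $T$ is $T'(x,b_2,\dots,b_n)=T(x,x,b_2,\dots,b_n)$, $x\in H$ (real-valued here since $T$ is symmetric). *)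

theory Defs
  imports Complex_Main "HOL-Library.FuncSet"
begin

text \<open>
  Tuples \<open>(c\<^sub>2, \<dots>, c\<^sub>n)\<close> are functions on \<open>{2..n}\<close>, extended by \<open>undefined\<close>; likewise a
  functional is a function that is \<open>undefined\<close> outside its domain. For \<open>n = 1\<close> the tuple
  is empty and \<open>T\<close> amounts to a map on \<open>H \<times> H\<close>.
\<close>

definition tuple :: "nat \<Rightarrow> (nat \<Rightarrow> 'h) \<Rightarrow> nat \<Rightarrow> 'h" where
  "tuple n b = restrict b {2..n}"

text \<open>
  The parameter \<open>conj\<close> is the conjugation of the scalar field: \<open>id\<close> on the reals, \<open>cnj\<close> on
  the complex numbers. Only the values of \<open>T\<close> at the fixed tuple \<open>b\<close> are constrained; no
  linearity in the last \<open>n - 1\<close> arguments is required.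
\<close>

locale b_sesquilinear = vector_space scale
  for scale :: "'k::field \<Rightarrow> 'h::ab_group_add \<Rightarrow> 'h" +
  fixes conj :: "'k \<Rightarrow> 'k"
    and n :: nat
    and b :: "nat \<Rightarrow> 'h"
    and T :: "'h \<times> 'h \<times> (nat \<Rightarrow> 'h) \<Rightarrow> 'k"
  assumes domain: "T \<in> UNIV \<times> UNIV \<times> (\<Pi>\<^sub>E i\<in>{2..n}. span {b i}) \<rightarrow>\<^sub>E UNIV"
    and add_left: "T (x + y, z, tuple n b) = T (x, z, tuple n b) + T (y, z, tuple n b)"
    and scale_left: "T (scale \<alpha> x, y, tuple n b) = \<alpha> * T (x, y, tuple n b)"
    and add_right: "T (x, y + z, tuple n b) = T (x, y, tuple n b) + T (x, z, tuple n b)"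
    and scale_right: "T (x, scale \<beta> y, tuple n b) = conj \<beta> * T (x, y, tuple n b)"

locale symmetric_b_sesquilinear = b_sesquilinear +
  assumes symmetric: "T (x, y, tuple n b) = conj (T (y, x, tuple n b))"

definition quadratic_form :: "('h \<times> 'h \<times> 'c \<Rightarrow> 'k) \<Rightarrow> 'h \<times> 'c \<Rightarrow> 'k" where
  "quadratic_form T = (\<lambda>(x, c). T (x, x, c))"

end

theory Submission
  imports Defs
begin

text \<open>Write Q for the quadratic form and drop the fixed tuple. Expanding Q(x + y) - Q(x - y)
  by additivity leaves only cross terms, 2 (T(x, y) + T(y, x)); this is
  \<open>quadratic_form_diff\<close>, which carries both cases. Over the reals symmetry makes the
  two cross terms equal. Over the complex numbers the identity is also used with iy in place of y:
  multiplied by i, it yields 2 (T(x, y) - T(y, x)), and adding the two differences removes T(y,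
  x).\<close>

context b_sesquilinear
begin

lemma diff_left: "T (x - y, z, tuple n b) = T (x, z, tuple n b) - T (y, z, tuple n b)"
  using add_left[of "x - y" y z] by (simp add: algebra_simps)

text \<open>Additivity at (y - z) + z suffices, so \<open>conj\<close> (-1), with
  \<open>conj\<close> arbitrary here, need not be evaluated.\<close>

lemma diff_right: "T (x, y - z, tuple n b) = T (x, y, tuple n b) - T (x, z, tuple n b)"
  using add_right[of x "y - z" z] by (simp add: algebra_simps)

text \<open>The diagonal terms T(x, x) and T(y, y) cancel, while the mixed terms change sign with y
  and so double. Symmetry is kept out so that both scalar fields can share the identity.\<close>

lemma quadratic_form_diff:
  "quadratic_form T (x + y, tuple n b) - quadratic_form T (x - y, tuple n b)
    = 2 * (T (x, y, tuple n b) + T (y, x, tuple n b))"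
  by (simp add: quadratic_form_def add_left add_right diff_left diff_right)

end

theorem theorem4p6:
  fixes n :: nat
  assumes "n \<ge> 1"
  shows
    "(\<forall>(scale :: real \<Rightarrow> 'h::ab_group_add \<Rightarrow> 'h) b T.
        symmetric_b_sesquilinear scale id n b T \<longrightarrow>
        (let T' = (\<lambda>x. quadratic_form T (x, tuple n b)) in
         \<forall>x y. T (x, y, tuple n b) = 1/4 * (T' (x + y) - T' (x - y))))
   \<and> (\<forall>(scale :: complex \<Rightarrow> 'g::ab_group_add \<Rightarrow> 'g) b T.
        symmetric_b_sesquilinear scale cnj n b T \<longrightarrow>
        (let T' = (\<lambda>x. quadratic_form T (x, tuple n b)) in
         \<forall>x y. T (x, y, tuple n b) =
           1/4 * (T' (x + y) - T' (x - y))
           + 1/4 * (\<i> * T' (x + scale \<i> y) - \<i> * T' (x - scale \<i> y))))"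
proof (intro conjI allI impI)
  fix scale :: "real \<Rightarrow> 'h \<Rightarrow> 'h" and b T
  assume "symmetric_b_sesquilinear scale id n b T"
  then interpret symmetric_b_sesquilinear scale id n b T .
  show "let T' = (\<lambda>x. quadratic_form T (x, tuple n b)) in
         \<forall>x y. T (x, y, tuple n b) = 1/4 * (T' (x + y) - T' (x - y))"
    unfolding Let_def quadratic_form_diff
  proof (intro allI)
    fix x y
    show "T (x, y, tuple n b) = 1/4 * (2 * (T (x, y, tuple n b) + T (y, x, tuple n b)))"
      \<comment> \<open>Here \<open>conj\<close> is \<open>id\<close>, so symmetry reads T(x, y) =
        T(y, x).\<close>
      using symmetric[of x y] by simp
  qed
next
  fix scale :: "complex \<Rightarrow> 'g \<Rightarrow> 'g" and b T
  assume "symmetric_b_sesquilinear scale cnj n b T"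
  then interpret symmetric_b_sesquilinear scale cnj n b T .
  show "let T' = (\<lambda>x. quadratic_form T (x, tuple n b)) in
         \<forall>x y. T (x, y, tuple n b) =
           1/4 * (T' (x + y) - T' (x - y))
           + 1/4 * (\<i> * T' (x + scale \<i> y) - \<i> * T' (x - scale \<i> y))"
    \<comment> \<open>Factoring out \<i> exposes a difference of quadratic forms, to which
      \<open>quadratic_form_diff\<close> applies with \<open>scale \<i> y\<close> for
      \<open>y\<close>.\<close>
    unfolding Let_def right_diff_distrib[of \<i>, symmetric] quadratic_form_diff
    \<comment> \<open>The new cross terms are -i T(x, y), since \<open>cnj \<i>\<close> = -i, and i
      T(y, x); the outer factor i turns them into T(x, y) and -T(y, x).\<close>
    by (simp add: scale_left scale_right algebra_simps)
qed

end
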